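(* Let $q$ be a complex number with $0<|q|<1$, and let $a,z$ be nonzero complex numbers with $z\neq -a$, $z\neq -1/a$, and $zq^{2k+1}\neq 1$, $q^{2k+1}/z\neq 1$ for all integers $k\ge 0$. Then \[ N^o(a,1/a;z;q)+\frac{1}{(z+a)\left(1+\frac{1}{az}\right)}=\frac{\left(-aq,-q/a;q^2\right)_{\infty}}{(z+a)\left(1+\frac{1}{az}\right)\left(zq,q/z;q^2\right)_{\infty}}. \]
   Context: For $|q|<1$, $c\in\mathbb{C}$ and $n\in\mathbb{Z}_{\ge0}\cup\{\infty\}$ write $(c;q)_n=\prod_{k=0}^{n-1}(1-cq^k)$ and $(c_1,\dots,c_j;q)_n=(c_1;q)_n\cdots(c_j;q)_n$. For complex $a,b,z$ define \[ N^o(a,b;z;q):=\sum_{n\ge0}\frac{\left(-q/a,-q/b;q^2\right)_n(ab)^nq^{2n+1}}{\left(zq,q/z;q^2\right)_{n+1}}, \] where $(-q/a;q^2)_n a^n$ is understood as $\prod_{k=0}^{n-1}(a+q^{2k+1})$ (and similarly for $b$), so that $a=0$ or $b=0$ is allowed. *)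

theory Defs
  imports "HOL-Analysis.Analysis"
begin

definition qpoch :: "complex \<Rightarrow> complex \<Rightarrow> nat \<Rightarrow> complex" where
  "qpoch c q n = (\<Prod>k<n. 1 - c * q ^ k)"

definition qpoch_inf :: "complex \<Rightarrow> complex \<Rightarrow> complex" where
  "qpoch_inf c q = (\<Prod>k. 1 - c * q ^ k)"

lemma convergent_qpoch_inf:
  fixes c q :: complex
  assumes "norm q < 1"
  shows "convergent_prod (\<lambda>k. 1 - c * q ^ k)"
proof -
  have "norm ((1 - c * q ^ k) - 1) = norm c * norm q ^ k" for k
    by (simp add: norm_mult norm_power)
  moreover have "summable (\<lambda>k. norm c * norm q ^ k)"
    using assms by (intro summable_mult summable_geometric) simp
  ultimately have "summable (\<lambda>k. norm ((1 - c * q ^ k) - 1))"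
    by presburger
  then show ?thesis
    by (intro abs_convergent_prod_imp_convergent_prod summable_imp_abs_convergent_prod)
qed

text \<open>
  \<open>qpoch_scaled a q n\<close> is the polynomial-in-\<open>a\<close> form of
  \<open>(-q/a; q\<^sup>2)\<^sub>n a\<^sup>n\<close>, which also makes sense for \<open>a = 0\<close>.
\<close>

definition qpoch_scaled :: "complex \<Rightarrow> complex \<Rightarrow> nat \<Rightarrow> complex" where
  "qpoch_scaled a q n = (\<Prod>k<n. a + q ^ (2 * k + 1))"

lemma qpoch_scaled_eq:
  fixes a q :: complex
  assumes "a \<noteq> 0"
  shows "qpoch_scaled a q n = qpoch (- q / a) (q\<^sup>2) n * a ^ n"
proof -
  have "a + q ^ (2 * k + 1) = (1 - (- q / a) * (q\<^sup>2) ^ k) * a" for k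
    using assms by (simp add: field_simps flip: power_mult)
  then have "qpoch_scaled a q n = (\<Prod>k<n. (1 - (- q / a) * (q\<^sup>2) ^ k) * a)"
    unfolding qpoch_scaled_def by (intro prod.cong) auto
  then show ?thesis
    by (simp add: qpoch_def prod.distrib)
qed

definition N_odd :: "complex \<Rightarrow> complex \<Rightarrow> complex \<Rightarrow> complex \<Rightarrow> complex" where
  "N_odd a b z q =
     (\<Sum>n. qpoch_scaled a q n * qpoch_scaled b q n * q ^ (2 * n + 1) /
           (qpoch (z * q) (q\<^sup>2) (n + 1) * qpoch (q / z) (q\<^sup>2) (n + 1)))"

end

theory Submission
  imports Defs
begin

text \<open>
  The series telescopes. With \<open>C = (z + a)(1 + 1/(az)) = a + 1/a + z + 1/z\<close> one has
  \<open>(1 + ax)(1 + x/a) - (1 - zx)(1 - x/z) = Cx\<close>. Hence for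
  \<open>R\<^sub>n = (-aq, -q/a; q\<^sup>2)\<^sub>n / (zq, q/z; q\<^sup>2)\<^sub>n\<close> the choice \<open>x = q\<^bsup>2n+1\<^esup>\<close> shows that
  \<open>R\<^bsub>n+1\<^esub> - R\<^sub>n\<close> is \<open>C\<close> times the \<open>n\<close>-th summand of \<open>N\<^sup>o(a, 1/a; z; q)\<close>.
\<close>

lemma qpoch_0 [simp]: "qpoch c q 0 = 1"
  by (simp add: qpoch_def)

lemma qpoch_Suc: "qpoch c q (Suc n) = qpoch c q n * (1 - c * q ^ n)"
  by (simp add: qpoch_def)

lemma qpoch_LIMSEQ:
  assumes "norm q < 1"
  shows "qpoch c q \<longlonglongrightarrow> qpoch_inf c q"
proof -
  \<comment> \<open>The library limit concerns products over k \<le> n, which are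
    \<open>qpoch c q (Suc n)\<close>; the shift of index does not affect the limit.\<close>
  have "(\<lambda>n. \<Prod>k\<le>n. 1 - c * q ^ k) \<longlonglongrightarrow> qpoch_inf c q"
    unfolding qpoch_inf_def by (intro convergent_prod_LIMSEQ convergent_qpoch_inf assms)
  then have "(\<lambda>n. qpoch c q (Suc n)) \<longlonglongrightarrow> qpoch_inf c q"
    by (simp add: qpoch_def lessThan_Suc_atMost)
  then show ?thesis
    by (simp only: filterlim_sequentially_Suc)
qed

lemma qpoch_nonzero:
  assumes "\<And>k. c * q ^ k \<noteq> 1"
  shows "qpoch c q n \<noteq> 0"
  using assms by (simp add: qpoch_def)

text \<open>A convergent infinite product vanishes only if one of its factors does. This permits
  division by the limit of the denominators.\<close>

lemma qpoch_inf_nonzero: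
  assumes "norm q < 1" and "\<And>k. c * q ^ k \<noteq> 1"
  shows "qpoch_inf c q \<noteq> 0"
  unfolding qpoch_inf_def
  using assms by (intro prodinf_nonzero convergent_qpoch_inf) auto

text \<open>The powers a^n and (1/a)^n cancel, and -q/(1/a) = -aq. This turns the numerators of the
  series into those of the telescoping quotients.\<close>

lemma qpoch_scaled_mult_inverse:
  assumes "a \<noteq> 0"
  shows "qpoch_scaled a q n * qpoch_scaled (1 / a) q n =
    qpoch (- a * q) (q\<^sup>2) n * qpoch (- q / a) (q\<^sup>2) n"
proof -
  have "qpoch_scaled (1 / a) q n = qpoch (- a * q) (q\<^sup>2) n * (1 / a) ^ n"
    using assms by (simp add: qpoch_scaled_eq mult.commute)
  then show ?thesis
    using assms by (simp add: qpoch_scaled_eq power_one_over)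
qed

theorem theorem1p1:
  fixes q a z :: complex
  assumes "0 < norm q" and "norm q < 1"
    and "a \<noteq> 0" and "z \<noteq> 0"
    and "z \<noteq> - a" and "z \<noteq> - 1 / a"
    and "\<And>k::nat. z * q ^ (2 * k + 1) \<noteq> 1"
    and "\<And>k::nat. q ^ (2 * k + 1) / z \<noteq> 1"
  shows "N_odd a (1 / a) z q + 1 / ((z + a) * (1 + 1 / (a * z))) =
    (qpoch_inf (- a * q) (q\<^sup>2) * qpoch_inf (- q / a) (q\<^sup>2)) /
    ((z + a) * (1 + 1 / (a * z)) * (qpoch_inf (z * q) (q\<^sup>2) * qpoch_inf (q / z) (q\<^sup>2)))"
proof -
  define C where "C = (z + a) * (1 + 1 / (a * z))"
  define P where "P n = qpoch (- a * q) (q\<^sup>2) n * qpoch (- q / a) (q\<^sup>2) n" for n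
  define D where "D n = qpoch (z * q) (q\<^sup>2) n * qpoch (q / z) (q\<^sup>2) n" for n
  define Pinf where "Pinf = qpoch_inf (- a * q) (q\<^sup>2) * qpoch_inf (- q / a) (q\<^sup>2)"
  define Dinf where "Dinf = qpoch_inf (z * q) (q\<^sup>2) * qpoch_inf (q / z) (q\<^sup>2)"
  have q2: "norm (q\<^sup>2) < 1"
    using assms(2) by (simp add: norm_power power_less_one_iff)
  have pole1: "z * q * (q\<^sup>2) ^ k \<noteq> 1" and pole2: "q / z * (q\<^sup>2) ^ k \<noteq> 1" for k
    using assms(7)[of k] assms(8)[of k] by (simp_all add: mult_ac flip: power_mult)
  have D_nz: "D n \<noteq> 0" for n
    using qpoch_nonzero[OF pole1] qpoch_nonzero[OF pole2] by (simp add: D_def)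
  have Dinf_nz: "Dinf \<noteq> 0"
    using qpoch_inf_nonzero[OF q2 pole1] qpoch_inf_nonzero[OF q2 pole2] by (simp add: Dinf_def)
  \<comment> \<open>The two conditions excluding z = -a and z = -1/a say that neither factor of
    \<open>C\<close> vanishes.\<close>
  have "z + a \<noteq> 0"
    using assms(5) by (simp add: eq_neg_iff_add_eq_0)
  moreover have "1 + 1 / (a * z) \<noteq> 0"
    using assms(3,4,6) by (simp add: field_simps eq_neg_iff_add_eq_0)
  ultimately have C_nz: "C \<noteq> 0"
    by (simp add: C_def)

  have diff: "P n * q ^ (2 * n + 1) / D (Suc n) = (P (Suc n) / D (Suc n) - P n / D n) / C" for n
  proof -
    define x where "x = q ^ (2 * n + 1)"
    define d where "d = (1 - z * x) * (1 - x / z)"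
    have x: "q * (q\<^sup>2) ^ n = x"
      by (simp add: x_def flip: power_mult)
    have D: "D (Suc n) = D n * d"
      by (simp add: D_def d_def qpoch_Suc mult_ac flip: x)
    have "P (Suc n) = P n * ((1 + a * x) * (1 + x / a))"
      by (simp add: P_def qpoch_Suc mult_ac flip: x)
    \<comment> \<open>Both quadratics in x have constant and leading coefficient 1, so they differ
      only in the linear term: a + 1/a against -(z + 1/z).\<close>
    also have "(1 + a * x) * (1 + x / a) = d + C * x"
      using assms(3,4) by (simp add: C_def d_def field_simps)
    finally have P: "P (Suc n) = P n * (d + C * x)" .
    have "d \<noteq> 0"
      using D_nz[of "Suc n"] by (simp add: D)
    then show ?thesis
      using C_nz D_nz[of n] unfolding D P x_def[symmetric] by (simp add: field_simps)
  qed
  have "(\<lambda>n. P n / D n) \<longlonglongrightarrow> Pinf / Dinf"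
    unfolding P_def D_def Pinf_def Dinf_def
    by (intro tendsto_divide tendsto_mult qpoch_LIMSEQ q2 Dinf_nz[unfolded Dinf_def])
  then have "(\<lambda>n. (P (Suc n) / D (Suc n) - P n / D n) / C) sums ((Pinf / Dinf - P 0 / D 0) / C)"
    by (intro sums_divide telescope_sums)
  \<comment> \<open>The initial quotient \<open>P 0 / D 0\<close> consists of empty products and
    equals 1; it produces the term 1/C that the theorem adds to the series.\<close>
  then have "(\<lambda>n. P n * q ^ (2 * n + 1) / D (Suc n)) sums ((Pinf / Dinf - 1) / C)"
    by (simp only: diff) (simp add: P_def D_def)
  then have "N_odd a (1 / a) z q = (Pinf / Dinf - 1) / C"
    using assms(3) by (simp add: N_odd_def qpoch_scaled_mult_inverse P_def D_def sums_iff)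
  then have "N_odd a (1 / a) z q + 1 / C = Pinf / (C * Dinf)"
    by (simp add: diff_divide_distrib mult.commute)
  then show ?thesis
    by (simp only: C_def Pinf_def Dinf_def)
qed

end
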